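(* Let $s$ be a nonzero integer and consider the cyclic system of $n$ simultaneous congruences $$ \frac{\prod_{k=1}^n q_k}{q_i} \equiv s \pmod{|q_i|}, \qquad 1 \le i \le n. $$ (1) For each $n \ge 2$ this system has infinitely many integer solutions $(q_1, \dots, q_n) \in (\mathbb{Z}\setminus\{0\})^n$ with at least two indices $i$ having $|q_i| \ge 2$ and with $\gcd(q_1 q_2 \cdots q_n, s) = 1$. (2) For each $n \ge 2$ there exists an integer $M_n^{\ast}$ such that whenever $\gcd(s, M_n^{\ast}) = 1$, this system has infinitely many integer solutions $(q_1,\dots,q_n)\in(\mathbb{Z}\setminus\{0\})^n$ satisfying $\gcd(q_1 q_2 \cdots q_n, s) = 1$ and $\min_i\{|q_i|\} \ge 2$. An allowable value is $M_n^{\ast} = u_1 u_2 \cdots u_n$, where $u_i$ are the terms of Sylvester's sequence.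
   Context: Sylvester's sequence is defined by $u_0 = 1$ and $u_{n+1} = \left(\prod_{i=1}^{n} u_i\right) + 1$ for $n\ge 0$, i.e. $u_1=2, u_2=3, u_3=7, u_4=43, u_5=1807, \dots$ (equivalently $u_1=2$ and $u_{n+1}=\prod_{i=1}^n u_i+1$). *)

theory Defs
  imports Complex_Main "HOL-Library.FuncSet" "HOL-Number_Theory.Cong"
begin

fun sylvester :: "nat \<Rightarrow> int" where
  "sylvester 0 = 1"
| "sylvester (Suc n) = (\<Prod>i = 1..n. sylvester i) + 1"

text \<open>
  An n-tuple of integers is an extensional function on \<open>{1..n}\<close>, so that distinct functions
  are distinct tuples and infinitude of a set of solutions has its intended meaning.
  The division below is exact because all entries are nonzero.
\<close>

definition cyclic_solutions :: "int \<Rightarrow> nat \<Rightarrow> (nat \<Rightarrow> int) set" where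
  "cyclic_solutions s n =
     {q \<in> {1..n} \<rightarrow>\<^sub>E (UNIV - {0}).
        \<forall>i\<in>{1..n}. [(\<Prod>k = 1..n. q k) div q i = s] (mod \<bar>q i\<bar>)}"

definition allowable_modulus :: "nat \<Rightarrow> int \<Rightarrow> bool" where
  "allowable_modulus n M \<longleftrightarrow>
     (\<forall>s. s \<noteq> 0 \<longrightarrow> gcd s M = 1 \<longrightarrow>
        infinite {q \<in> cyclic_solutions s n.
                    gcd (\<Prod>k = 1..n. q k) s = 1 \<and>
                    Min ((\<lambda>i. \<bar>q i\<bar>) ` {1..n}) \<ge> 2})"

end

theory Submission
  imports Defs
begin

text \<open>
  Suppose that for every \<open>i < n\<close> the product of the other \<open>r j\<close> with \<open>j < n\<close> is \<open>1\<close> modulo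
  \<open>r i\<close>. Then adjoining \<open>q n = s - r 1 \<cdots> r (n - 1)\<close> solves the cyclic system: modulo \<open>r i\<close> the
  new entry is \<open>s\<close>, and modulo the new entry the old product is \<open>s\<close>.

  For (1) take \<open>r = (1, \<dots>, 1, -m)\<close> with \<open>m \<equiv> 1\<close> modulo \<open>s\<close>. For (2) take \<open>r 1 = -m\<close> and
  \<open>r (k + 1) = 1 - r 1 \<cdots> r k\<close>. For \<open>m = 1\<close> this is \<open>-1, 2, 3, 7, 43, \<dots>\<close>, that is \<open>-1\<close> followed
  by Sylvester's sequence, so if \<open>m \<equiv> 1\<close> modulo \<open>s\<close> then the \<open>r i\<close> are coprime to \<open>s\<close>
  as soon as Sylvester's numbers are. Letting \<open>m\<close> grow gives infinitely many solutions.
\<close>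

section \<open>Adjoining a last entry to a tuple\<close>

text \<open>Restricted to \<open>{1..n}\<close> so that the tuple is extensional, as membership in
  \<open>cyclic_solutions\<close> demands.\<close>

definition adjoin_entry :: "int \<Rightarrow> nat \<Rightarrow> (nat \<Rightarrow> int) \<Rightarrow> nat \<Rightarrow> int" where
  "adjoin_entry s n r = (\<lambda>i\<in>{1..n}. if i = n then s - prod r {1..<n} else r i)"

lemma adjoin_entry_less: "i \<in> {1..<n} \<Longrightarrow> adjoin_entry s n r i = r i"
  by (simp add: adjoin_entry_def)

lemma adjoin_entry_last: "n \<ge> 1 \<Longrightarrow> adjoin_entry s n r n = s - prod r {1..<n}"
  by (simp add: adjoin_entry_def)

lemma prod_adjoin_entry:
  assumes "n \<ge> 1"
  shows "prod (adjoin_entry s n r) {1..n} = prod r {1..<n} * (s - prod r {1..<n})"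
proof -
  have "{1..n} = insert n {1..<n}"
    using assms by auto
  moreover have "prod (adjoin_entry s n r) {1..<n} = prod r {1..<n}"
    by (rule prod.cong) (simp_all add: adjoin_entry_less)
  ultimately show ?thesis
    using assms by (simp add: adjoin_entry_last mult.commute)
qed

text \<open>Modulo \<open>s\<close> the adjoined entry is minus the old product, so it inherits
  coprimality to \<open>s\<close>.\<close>

lemma gcd_prod_adjoin_entry:
  assumes "n \<ge> 1" and "coprime (prod r {1..<n}) s"
  shows "gcd (prod (adjoin_entry s n r) {1..n}) s = 1"
proof -
  have "coprime (s - prod r {1..<n}) s"
    by (rule cong_imp_coprime[of "- prod r {1..<n}"])
       (use assms(2) in \<open>simp_all add: cong_iff_dvd_diff\<close>)
  then show ?thesis
    using assms by (simp add: prod_adjoin_entry coprime_iff_gcd_eq_1 [symmetric] del: One_nat_def)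
qed

lemma adjoin_entry_in_cyclic_solutions:
  assumes "n \<ge> 1"
    and nz: "\<And>i. i \<in> {1..<n} \<Longrightarrow> r i \<noteq> 0"
    and last: "s - prod r {1..<n} \<noteq> 0"
    and cong: "\<And>i. i \<in> {1..<n} \<Longrightarrow> [prod r ({1..<n} - {i}) = 1] (mod r i)"
  shows "adjoin_entry s n r \<in> cyclic_solutions s n"
proof -
  let ?q = "adjoin_entry s n r" and ?P = "prod r {1..<n}"
  have "[prod ?q {1..n} div ?q i = s] (mod \<bar>?q i\<bar>)" if i: "i \<in> {1..n}" for i
  proof (cases "i = n")
    case True
    have "[?P = s] (mod s - ?P)"
      by (simp add: cong_iff_dvd_diff dvd_diff_commute)
    then show ?thesis
      using True assms(1) last by (simp add: prod_adjoin_entry adjoin_entry_last del: One_nat_def)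
  next
    case False
    with i have i': "i \<in> {1..<n}" by auto
    let ?R = "prod r ({1..<n} - {i})"
    have P: "?P = r i * ?R"
      using i' by (simp add: prod.remove)
    have "[s - ?P = s] (mod r i)"
      unfolding P by (simp add: cong_iff_dvd_diff)
    with cong[OF i'] have "[?R * (s - ?P) = 1 * s] (mod r i)"
      by (rule cong_mult)
    moreover have "prod ?q {1..n} div r i = ?R * (s - ?P)"
      using nz[OF i'] assms(1) by (simp add: prod_adjoin_entry P mult.assoc del: One_nat_def)
    ultimately show ?thesis
      using i' by (simp add: adjoin_entry_less)
  qed
  moreover have "?q \<in> {1..n} \<rightarrow>\<^sub>E (UNIV - {0})"
    using nz last by (auto simp: adjoin_entry_def)
  ultimately show ?thesis
    by (simp add: cyclic_solutions_def)
qed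

text \<open>Adjoining leaves coordinate \<open>i < n\<close> unchanged, so this one coordinate
  already separates the tuples for different \<open>t\<close>.\<close>

lemma infinite_adjoin_entry:
  fixes r :: "nat \<Rightarrow> nat \<Rightarrow> int"
  assumes "i \<in> {1..<n}" and "inj (\<lambda>t. r t i)"
    and "\<And>t. adjoin_entry s n (r t) \<in> A"
  shows "infinite A"
proof -
  have "inj (\<lambda>t. adjoin_entry s n (r t) i)"
    using assms(2) by (simp add: adjoin_entry_less[OF assms(1)])
  then have "inj (\<lambda>t. adjoin_entry s n (r t))"
    by (auto simp: inj_def)
  moreover have "range (\<lambda>t. adjoin_entry s n (r t)) \<subseteq> A"
    using assms(3) by blast
  ultimately show ?thesis
    by (meson finite_imageD finite_subset infinite_UNIV_nat)
qed

section \<open>Solutions with two large entries\<close>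

text \<open>These are the values of \<open>m\<close>. The offset 3 ensures
  \<open>m >= abs s + 2\<close>, hence \<open>s + m >= 2\<close> whatever the sign of
  \<open>s\<close>.\<close>

definition large_unit :: "int \<Rightarrow> nat \<Rightarrow> int" where
  "large_unit s t = 1 + (int t + 3) * \<bar>s\<bar>"

lemma large_unit_ge:
  assumes "s \<noteq> 0"
  shows "large_unit s t \<ge> \<bar>s\<bar> + 2"
proof -
  have "3 * \<bar>s\<bar> \<le> (int t + 3) * \<bar>s\<bar>"
    by (rule mult_right_mono) auto
  then show ?thesis
    using assms unfolding large_unit_def by linarith
qed

lemma cong_large_unit: "[large_unit s t = 1] (mod s)"
  by (simp add: large_unit_def cong_iff_dvd_diff)

lemma inj_uminus_large_unit: "s \<noteq> 0 \<Longrightarrow> inj (\<lambda>t. - large_unit s t)"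
  by (auto simp: inj_def large_unit_def)

lemma infinite_cyclic_solutions:
  fixes s :: int
  assumes "s \<noteq> 0" and "n \<ge> 2"
  shows "infinite {q \<in> cyclic_solutions s n.
    card {i \<in> {1..n}. \<bar>q i\<bar> \<ge> 2} \<ge> 2 \<and> gcd (\<Prod>k = 1..n. q k) s = 1}"
proof -
  define r :: "nat \<Rightarrow> nat \<Rightarrow> int"
    where "r t i = (if i = n - 1 then - large_unit s t else 1)" for t i
  have n1: "n - 1 \<in> {1..<n}"
    using assms(2) by auto
  have prod: "prod (r t) {1..<n} = - large_unit s t" for t
    unfolding r_def using n1 by (subst prod.delta) simp_all
  show ?thesis
  proof (rule infinite_adjoin_entry)
    show "n - 1 \<in> {1..<n}"
      by (rule n1)
    show "inj (\<lambda>t. r t (n - 1))"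
      using inj_uminus_large_unit[OF assms(1)] by (simp add: r_def)
  next
    fix t
    let ?q = "adjoin_entry s n (r t)"
    note ge = large_unit_ge[OF assms(1), of t]
    have "coprime (prod (r t) {1..<n}) s"
      using cong_imp_coprime[OF cong_sym[OF cong_large_unit[of s t]]]
      by (simp add: prod del: One_nat_def)
    then have "gcd (prod ?q {1..n}) s = 1"
      using assms(2) by (intro gcd_prod_adjoin_entry) auto
    moreover have "?q \<in> cyclic_solutions s n"
    proof (rule adjoin_entry_in_cyclic_solutions)
      show "s - prod (r t) {1..<n} \<noteq> 0"
        using ge unfolding prod by linarith
      show "r t i \<noteq> 0" for i
        using ge by (auto simp: r_def)
      show "[prod (r t) ({1..<n} - {i}) = 1] (mod r t i)" for i
      \<comment> \<open>At \<open>n - 1\<close> all other entries are 1; elsewhere the modulus is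
        1.\<close>
      proof (cases "i = n - 1")
        case True
        then have "prod (r t) ({1..<n} - {i}) = 1"
          by (intro prod.neutral) (auto simp: r_def)
        then show ?thesis by simp
      qed (simp add: r_def)
    qed (use assms(2) in simp)
    moreover have "card {i \<in> {1..n}. \<bar>?q i\<bar> \<ge> 2} \<ge> 2"
    proof -
      have "?q (n - 1) = - large_unit s t" "?q n = s + large_unit s t"
        using assms(2) adjoin_entry_less[OF n1] adjoin_entry_last[of n s "r t"] prod[of t]
        by (simp_all add: r_def)
      then have "{n - 1, n} \<subseteq> {i \<in> {1..n}. \<bar>?q i\<bar> \<ge> 2}"
        using ge assms(2) by auto
      then have "card {n - 1, n} \<le> card {i \<in> {1..n}. \<bar>?q i\<bar> \<ge> 2}"
        by (intro card_mono) auto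
      then show ?thesis
        using assms(2) by simp
    qed
    ultimately show "?q \<in> {q \<in> cyclic_solutions s n.
        card {i \<in> {1..n}. \<bar>q i\<bar> \<ge> 2} \<ge> 2 \<and> gcd (\<Prod>k = 1..n. q k) s = 1}"
      by simp
  qed
qed

section \<open>The sequence starting \<open>-m\<close>, \<open>1 + m\<close> and its
  congruences\<close>

text \<open>The value at \<open>0\<close> is a dummy: the sequence starts at index \<open>1\<close>.\<close>

fun shifted_sylvester :: "int \<Rightarrow> nat \<Rightarrow> int" where
  "shifted_sylvester m 0 = 1"
| "shifted_sylvester m (Suc k) =
     (if k = 0 then - m else 1 - (\<Prod>i = 1..k. shifted_sylvester m i))"

declare sylvester.simps(2) [simp del] shifted_sylvester.simps(2) [simp del]

lemma shifted_sylvester_1: "shifted_sylvester m 1 = - m"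
  by (simp add: shifted_sylvester.simps(2))

lemma shifted_sylvester_eq:
  "k \<ge> 2 \<Longrightarrow> shifted_sylvester m k = 1 - prod (shifted_sylvester m) {1..<k}"
  by (cases k) (simp_all add: shifted_sylvester.simps(2) atLeastLessThanSuc_atLeastAtMost)

text \<open>Each new factor turns the product \<open>P\<close> into \<open>P - P * P\<close>, so the
  products never increase from their first value \<open>-m\<close>.\<close>

lemma prod_shifted_sylvester_le:
  assumes "m \<ge> 0" and "n \<ge> 2"
  shows "prod (shifted_sylvester m) {1..<n} \<le> - m"
  using assms(2)
proof (induction n rule: dec_induct)
  case base
  have "{1..<2::nat} = {1}" by auto
  then show ?case by (simp add: shifted_sylvester_1 del: One_nat_def)
next
  case (step n)
  let ?P = "prod (shifted_sylvester m) {1..<n}"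
  have "prod (shifted_sylvester m) {1..<Suc n} = ?P * (1 - ?P)"
    using step.hyps by (simp add: shifted_sylvester_eq)
  also have "\<dots> = ?P - ?P * ?P"
    by (simp add: algebra_simps)
  also have "\<dots> \<le> - m"
    using step.IH zero_le_square[of ?P] by linarith
  finally show ?case .
qed

text \<open>From index 2 on, a term is 1 minus a product that is at most \<open>-m\<close>, hence at
  least \<open>1 + m\<close>.\<close>

lemma abs_shifted_sylvester_ge:
  assumes "m \<ge> 2" and "i \<ge> 1"
  shows "\<bar>shifted_sylvester m i\<bar> \<ge> 2"
proof (cases "i = 1")
  case True
  then show ?thesis
    using assms(1) by (simp add: shifted_sylvester_1 del: One_nat_def)
next
  case False
  then show ?thesis
    using assms prod_shifted_sylvester_le[of m i] by (simp add: shifted_sylvester_eq)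
qed

text \<open>Term \<open>i\<close> is a factor of the product that is subtracted from 1 to form term
  \<open>j\<close>.\<close>

lemma shifted_sylvester_cong_1:
  assumes "1 \<le> i" and "i < j"
  shows "[shifted_sylvester m j = 1] (mod shifted_sylvester m i)"
proof -
  have "shifted_sylvester m i dvd prod (shifted_sylvester m) {1..<j}"
    using assms by (intro dvd_prodI) auto
  then show ?thesis
    using assms by (simp add: shifted_sylvester_eq cong_iff_dvd_diff)
qed

text \<open>The terms before \<open>i\<close> multiply to 1 minus term \<open>i\<close> (to the
  empty product if \<open>i = 1\<close>), and every later term is 1 modulo term
  \<open>i\<close>.\<close>

lemma prod_shifted_sylvester_remove_cong_1:
  assumes "i \<in> {1..<n}"
  shows "[prod (shifted_sylvester m) ({1..<n} - {i}) = 1] (mod shifted_sylvester m i)"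
proof -
  let ?r = "shifted_sylvester m"
  have "[prod ?r {1..<i} = 1] (mod ?r i)"
  proof (cases "i = 1")
    case False
    then have "prod ?r {1..<i} = 1 - ?r i"
      using assms by (simp add: shifted_sylvester_eq)
    then show ?thesis
      by (simp add: cong_iff_dvd_diff)
  qed simp
  moreover have "[prod ?r {i<..<n} = (\<Prod>j\<in>{i<..<n}. 1)] (mod ?r i)"
    using assms by (intro cong_prod shifted_sylvester_cong_1) auto
  ultimately have "[prod ?r {1..<i} * prod ?r {i<..<n} = 1 * (\<Prod>j\<in>{i<..<n}. 1)] (mod ?r i)"
    by (rule cong_mult)
  moreover have "{1..<n} - {i} = {1..<i} \<union> {i<..<n}"
    using assms by auto
  moreover have "prod ?r ({1..<i} \<union> {i<..<n}) = prod ?r {1..<i} * prod ?r {i<..<n}"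
    by (rule prod.union_disjoint) auto
  ultimately show ?thesis
    by simp
qed

text \<open>The recursions \<open>P * (1 - P)\<close> and \<open>S * (S + 1)\<close> of the two
  products agree under \<open>P = - S\<close>. The index shift comes from the extra first factor
  \<open>-m\<close>, which is -1 modulo \<open>s\<close>.\<close>

lemma prod_shifted_sylvester_cong:
  assumes "[m = 1] (mod s)"
  shows "[prod (shifted_sylvester m) {1..Suc k} = - (\<Prod>i = 1..k. sylvester i)] (mod s)"
proof (induction k)
  case 0
  show ?case
    using assms by (simp add: shifted_sylvester_1 [simplified] cong_minus_minus_iff)
next
  case (Suc k)
  let ?P = "prod (shifted_sylvester m) {1..Suc k}" and ?S = "\<Prod>i = 1..k. sylvester i"
  have "prod (shifted_sylvester m) {1..Suc (Suc k)} = ?P * (1 - ?P)"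
    by (simp add: shifted_sylvester.simps(2)[of m "Suc k"])
  moreover have "[?P * (1 - ?P) = - ?S * (1 - - ?S)] (mod s)"
    by (intro cong_mult cong_diff Suc.IH cong_refl)
  moreover have "(\<Prod>i = 1..Suc k. sylvester i) = ?S * (?S + 1)"
    by (simp add: sylvester.simps(2))
  ultimately show ?case
    by (simp only: minus_mult_left diff_minus_eq_add add.commute)
qed

section \<open>Solutions with all entries large\<close>

lemma allowable_modulus_sylvester:
  assumes "n \<ge> 2"
  shows "allowable_modulus n (\<Prod>i = 1..n. sylvester i)"
  unfolding allowable_modulus_def
proof (intro allI impI)
  fix s :: int
  assume s: "s \<noteq> 0" and gcd: "gcd s (\<Prod>i = 1..n. sylvester i) = 1"
  define r where "r t = shifted_sylvester (large_unit s t)" for t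
  show "infinite {q \<in> cyclic_solutions s n.
      gcd (\<Prod>k = 1..n. q k) s = 1 \<and> Min ((\<lambda>i. \<bar>q i\<bar>) ` {1..n}) \<ge> 2}"
  proof (rule infinite_adjoin_entry)
    show "1 \<in> {1..<n}"
      using assms by auto
    show "inj (\<lambda>t. r t 1)"
      using inj_uminus_large_unit[OF s] by (simp add: r_def shifted_sylvester_1 del: One_nat_def)
  next
    fix t
    let ?q = "adjoin_entry s n (r t)"
    note ge = large_unit_ge[OF s, of t]
    have abs_r: "\<bar>r t i\<bar> \<ge> 2" if "i \<in> {1..<n}" for i
      using that ge unfolding r_def by (intro abs_shifted_sylvester_ge) auto
    have "prod (r t) {1..<n} \<le> - large_unit s t"
      unfolding r_def using ge assms by (intro prod_shifted_sylvester_le) auto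
    \<comment> \<open>The adjoined entry is at least \<open>s + m\<close>.\<close>
    then have last: "s - prod (r t) {1..<n} \<ge> 2"
      using ge by linarith
    \<comment> \<open>The \<open>k + 1\<close> entries below \<open>n\<close> correspond to -1 and
      the first \<open>k\<close> Sylvester numbers.\<close>
    obtain k where k: "n = Suc (Suc k)"
      using assms by (metis add_2_eq_Suc le_Suc_ex)
    have "(\<Prod>i = 1..k. sylvester i) dvd (\<Prod>i = 1..n. sylvester i)"
      by (rule prod_dvd_prod_subset) (auto simp: k)
    moreover have "coprime (\<Prod>i = 1..n. sylvester i) s"
      using gcd by (simp only: coprime_iff_gcd_eq_1 gcd.commute)
    ultimately have "coprime (- (\<Prod>i = 1..k. sylvester i)) s"
      unfolding coprime_minus_left_iff by (rule coprime_divisors[OF _ dvd_refl])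
    moreover have "[- (\<Prod>i = 1..k. sylvester i) = prod (r t) {1..Suc k}] (mod s)"
      unfolding r_def by (rule cong_sym, rule prod_shifted_sylvester_cong, rule cong_large_unit)
    ultimately have "coprime (prod (r t) {1..Suc k}) s"
      by (rule cong_imp_coprime [rotated])
    then have "coprime (prod (r t) {1..<n}) s"
      by (simp only: k atLeastLessThanSuc_atLeastAtMost)
    then have "gcd (prod ?q {1..n}) s = 1"
      using assms by (intro gcd_prod_adjoin_entry) auto
    moreover have "?q \<in> cyclic_solutions s n"
    proof (rule adjoin_entry_in_cyclic_solutions)
      show "[prod (r t) ({1..<n} - {i}) = 1] (mod r t i)" if "i \<in> {1..<n}" for i
        using that unfolding r_def by (rule prod_shifted_sylvester_remove_cong_1)
      show "r t i \<noteq> 0" if "i \<in> {1..<n}" for i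
        using abs_r[OF that] by auto
    qed (use last assms in auto)
    moreover have "\<bar>?q i\<bar> \<ge> 2" if "i \<in> {1..n}" for i
      using that abs_r[of i] last by (cases "i = n") (auto simp: adjoin_entry_def)
    then have "Min ((\<lambda>i. \<bar>?q i\<bar>) ` {1..n}) \<ge> 2"
      using assms by (intro Min.boundedI) auto
    ultimately show "?q \<in> {q \<in> cyclic_solutions s n.
        gcd (\<Prod>k = 1..n. q k) s = 1 \<and> Min ((\<lambda>i. \<bar>q i\<bar>) ` {1..n}) \<ge> 2}"
      by simp
  qed
qed

theorem theorem1p2:
  "(\<forall>s::int. \<forall>n::nat. s \<noteq> 0 \<longrightarrow> n \<ge> 2 \<longrightarrow>
      infinite {q \<in> cyclic_solutions s n.
                  card {i \<in> {1..n}. \<bar>q i\<bar> \<ge> 2} \<ge> 2 \<and>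
                  gcd (\<Prod>k = 1..n. q k) s = 1}) \<and>
   (\<forall>n::nat. n \<ge> 2 \<longrightarrow>
      (\<exists>M. allowable_modulus n M) \<and>
      allowable_modulus n (\<Prod>i = 1..n. sylvester i))"
  \<comment> \<open>The Sylvester product is also the witness for \<open>M\<close>.\<close>
  by (intro conjI allI impI exI; rule infinite_cyclic_solutions allowable_modulus_sylvester; assumption)

end
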